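(* Let $\mathcal{D}\subseteq\mathbb{R}^d$ be compact. Let $\boldsymbol{g}:\Omega\times\mathcal{D}\to\mathbb{R}^d$ be a Gaussian process that is continuously differentiable with respect to the spatial variable, whose mean $\boldsymbol{m}$ is divergence-free and whose covariance kernel $\boldsymbol{K}$ has divergence-free columns (i.e. for each fixed $\boldsymbol{x}'\in\mathcal{D}$ every column of $\boldsymbol{x}\mapsto\boldsymbol{K}(\boldsymbol{x},\boldsymbol{x}')$ is divergence-free). Then $\boldsymbol{g}$ is divergence-free. Analogously, for $d\in\{2,3\}$: if the mean of such a process is rotation-free and its covariance kernel has rotation-free columns, then $\boldsymbol{g}$ is rotation-free.
   Context: $(\Omega,\mathcal{A},\mathbb{P})$ is a probability space. A function $\boldsymbol{g}:\Omega\times\mathcal{D}\to\mathbb{R}^d$ is a (vector-valued) Gaussian process if for every finite set of pairwise distinct points $\boldsymbol{x}_1,\dots,\boldsymbol{x}_N\in\mathcal{D}$ the random vectors $\boldsymbol{g}(\cdot,\boldsymbol{x}_1),\dots,\boldsymbol{g}(\cdot,\boldsymbol{x}_N)$ have a joint Gaussian distribution. Its mean is $\boldsymbol{m}(\boldsymbol{x})=\mathbb{E}[\boldsymbol{g}(\cdot,\boldsymbol{x})]$ and its covariance kernel is $\boldsymbol{K}(\boldsymbol{x},\boldsymbol{x}')=\mathbb{E}[(\boldsymbol{g}(\cdot,\boldsymbol{x})-\boldsymbol{m}(\boldsymbol{x}))(\boldsymbol{g}(\cdot,\boldsymbol{x}')-\boldsymbol{m}(\boldsymbol{x}'))^{\mathrm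 T}]\in\mathbb{R}^{d\times d}$. For a continuously differentiable field $\boldsymbol{v}=(v_1,\dots,v_d)$, $\operatorname{div}\boldsymbol{v}=\sum_{k=1}^d\partial v_k/\partial x_k$; for $d=3$, $\operatorname{curl}\boldsymbol{v}=(\partial_2v_3-\partial_3v_2,\ \partial_3v_1-\partial_1v_3,\ \partial_1v_2-\partial_2v_1)^{\mathrm T}$; for $d=2$, $\operatorname{curl}\boldsymbol{v}=\partial_1v_2-\partial_2v_1$. A field is divergence-free (rotation-free) if its divergence (curl) vanishes identically. A Gaussian process $\boldsymbol{g}$ on a compact set $\mathcal{D}$ which is continuously differentiable with respect to $\boldsymbol{x}$ is called divergence-free if $\operatorname{div}\boldsymbol{g}(\cdot,\boldsymbol{x})=0$ for all $\boldsymbol{x}\in\mathcal{D}$ and $\mathbb{P}$-almost everywhere on $\Omega$, and (for $d=2,3$) rotation-free if $\operatorname{curl}\boldsymbol{g}(\cdot,\boldsymbol{x})=0$ for all $\boldsymbol{x}\in\mathcal{D}$ and $\mathbb{P}$-almost everywhere on $\Omega$; the differential operators act on the spatial variable only. *)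

theory Defs
  imports "HOL-Probability.Probability"
begin

section \<open>Differential operators on a compact set\<close>

text \<open>
  A field on a set \<open>D\<close> is a total function of which only the values on \<open>D\<close> matter.
  As usual for a closed set, \<open>C\<^sup>1\<close> on \<open>D\<close> means: continuous on \<open>D\<close>, differentiable in the
  interior, with first partial derivatives extending continuously up to the boundary.
  The partial derivatives at a boundary point are the values of these extensions.  A point of
  \<open>D\<close> that is not a limit of interior points carries no partial derivatives; there
  the default value 0 is used, and nothing is required of the derivatives.
  Entry \<open>(i, k)\<close> of the Jacobian is the partial derivative of component \<open>i\<close> in
  direction \<open>k\<close>.
\<close>

definition jacobian_on :: "(real^'d) set \<Rightarrow> (real^'d \<Rightarrow> real^'d) \<Rightarrow> real^'d \<Rightarrow> real^'d^'d" where
  "jacobian_on D v x =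
    (if x \<in> interior D then jacobian v (at x)
     else if x \<in> closure (interior D)
       then Lim (at x within interior D) (\<lambda>y. jacobian v (at y))
     else 0)"

text \<open>Sanity check: \<open>jacobian_on\<close> is the continuous extension of the Jacobian whenever there is one.\<close>

lemma jacobian_on_eq:
  assumes "continuous_on (closure (interior D)) J" "\<forall>x\<in>interior D. (v has_derivative (\<lambda>h. J x *v h)) (at x)"
  "x \<in> closure (interior D)"
 shows "jacobian_on D v x = J x"
proof -
  have i: "jacobian v (at y) = J y" if "y \<in> interior D" for y
  proof -
    have "frechet_derivative v (at y) = (\<lambda>h. J y *v h)" using assms(2) that frechet_derivative_at by metis
    then show ?thesis by (simp add: jacobian_def)
  qed
  show ?thesis
  proof (cases "x \<in> interior D")
    case True then show ?thesis using i by (simp add: jacobian_on_def)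
  next
    case False
    have "(J \<longlongrightarrow> J x) (at x within interior D)"
      using assms(1,3) closure_subset continuous_on tendsto_within_subset by (metis)
    then have "((\<lambda>y. jacobian v (at y)) \<longlongrightarrow> J x) (at x within interior D)"
      by (rule Lim_transform_eventually) (auto simp: eventually_at_filter i)
    moreover have "at x within interior D \<noteq> bot"
      using False assms(3) by (metis closure_def UnE mem_Collect_eq trivial_limit_within)
    ultimately show ?thesis using False assms(3) by (simp add: jacobian_on_def tendsto_Lim)
  qed
qed

definition partial_on ::
  "(real^'d) set \<Rightarrow> 'd \<Rightarrow> (real^'d \<Rightarrow> real^'d) \<Rightarrow> 'd \<Rightarrow> real^'d \<Rightarrow> real" where
  "partial_on D k v i x = jacobian_on D v x $ i $ k"

text \<open>
  Continuity of \<open>jacobian_on D v\<close> at a boundary point forces the limit in its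
  definition to exist, so the last conjunct is exactly the existence of the continuous extension.
\<close>

definition C1_field_on :: "(real^'d) set \<Rightarrow> (real^'d \<Rightarrow> real^'d) \<Rightarrow> bool" where
  "C1_field_on D v \<longleftrightarrow>
    continuous_on D v \<and>
    (\<forall>x\<in>interior D. v differentiable (at x)) \<and>
    continuous_on (closure (interior D)) (jacobian_on D v)"

definition div_on :: "(real^'d) set \<Rightarrow> (real^'d \<Rightarrow> real^'d) \<Rightarrow> real^'d \<Rightarrow> real" where
  "div_on D v x = (\<Sum>k\<in>UNIV. partial_on D k v k x)"

definition curl2_on :: "(real^2) set \<Rightarrow> (real^2 \<Rightarrow> real^2) \<Rightarrow> real^2 \<Rightarrow> real" where
  "curl2_on D v x = partial_on D 1 v 2 x - partial_on D 2 v 1 x"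

definition curl3_on :: "(real^3) set \<Rightarrow> (real^3 \<Rightarrow> real^3) \<Rightarrow> real^3 \<Rightarrow> real^3" where
  "curl3_on D v x = vector
    [partial_on D 2 v 3 x - partial_on D 3 v 2 x,
     partial_on D 3 v 1 x - partial_on D 1 v 3 x,
     partial_on D 1 v 2 x - partial_on D 2 v 1 x]"

definition divergence_free_on :: "(real^'d) set \<Rightarrow> (real^'d \<Rightarrow> real^'d) \<Rightarrow> bool" where
  "divergence_free_on D v \<longleftrightarrow> C1_field_on D v \<and> (\<forall>x\<in>D. div_on D v x = 0)"

definition rotation_free2_on :: "(real^2) set \<Rightarrow> (real^2 \<Rightarrow> real^2) \<Rightarrow> bool" where
  "rotation_free2_on D v \<longleftrightarrow> C1_field_on D v \<and> (\<forall>x\<in>D. curl2_on D v x = 0)"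

definition rotation_free3_on :: "(real^3) set \<Rightarrow> (real^3 \<Rightarrow> real^3) \<Rightarrow> bool" where
  "rotation_free3_on D v \<longleftrightarrow> C1_field_on D v \<and> (\<forall>x\<in>D. curl3_on D v x = 0)"

section \<open>Vector-valued Gaussian processes\<close>

text \<open>
  Gaussian distributions may be degenerate (point masses, singular covariance matrices).
  Random vectors are jointly Gaussian iff every linear combination of all their
  components is Gaussian.
\<close>

definition gaussian_rv :: "'w measure \<Rightarrow> ('w \<Rightarrow> real) \<Rightarrow> bool" where
  "gaussian_rv M X \<longleftrightarrow>
    X \<in> borel_measurable M \<and>
    ((\<exists>\<mu> \<sigma>. \<sigma> > 0 \<and> distributed M lborel X (\<lambda>t. ennreal (normal_density \<mu> \<sigma> t)))
     \<or> (\<exists>\<mu>. AE \<omega> in M. X \<omega> = \<mu>))"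

definition jointly_gaussian :: "'w measure \<Rightarrow> 'i set \<Rightarrow> ('i \<Rightarrow> 'w \<Rightarrow> real^'d) \<Rightarrow> bool" where
  "jointly_gaussian M I X \<longleftrightarrow>
    (\<forall>i\<in>I. X i \<in> borel_measurable M) \<and>
    (\<forall>c :: 'i \<Rightarrow> real^'d. gaussian_rv M (\<lambda>\<omega>. \<Sum>i\<in>I. c i \<bullet> X i \<omega>))"

definition gaussian_process ::
  "'w measure \<Rightarrow> (real^'d) set \<Rightarrow> ('w \<Rightarrow> real^'d \<Rightarrow> real^'d) \<Rightarrow> bool" where
  "gaussian_process M D g \<longleftrightarrow>
    (\<forall>S. finite S \<and> S \<subseteq> D \<longrightarrow> jointly_gaussian M S (\<lambda>x \<omega>. g \<omega> x))"

definition gp_mean :: "'w measure \<Rightarrow> ('w \<Rightarrow> real^'d \<Rightarrow> real^'d) \<Rightarrow> real^'d \<Rightarrow> real^'d" where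
  "gp_mean M g x = (\<integral>\<omega>. g \<omega> x \<partial>M)"

definition gp_cov ::
  "'w measure \<Rightarrow> ('w \<Rightarrow> real^'d \<Rightarrow> real^'d) \<Rightarrow> real^'d \<Rightarrow> real^'d \<Rightarrow> real^'d^'d" where
  "gp_cov M g x x' =
    (\<integral>\<omega>. (\<chi> i j. (g \<omega> x - gp_mean M g x) $ i * (g \<omega> x' - gp_mean M g x') $ j) \<partial>M)"

definition C1_gaussian_process ::
  "'w measure \<Rightarrow> (real^'d) set \<Rightarrow> ('w \<Rightarrow> real^'d \<Rightarrow> real^'d) \<Rightarrow> bool" where
  "C1_gaussian_process M D g \<longleftrightarrow>
    gaussian_process M D g \<and> (\<forall>\<omega>\<in>space M. C1_field_on D (g \<omega>))"

text \<open>
  The exceptional null sets below do not depend on the point \<open>x\<close>.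
\<close>

definition divergence_free_process ::
  "'w measure \<Rightarrow> (real^'d) set \<Rightarrow> ('w \<Rightarrow> real^'d \<Rightarrow> real^'d) \<Rightarrow> bool" where
  "divergence_free_process M D g \<longleftrightarrow>
    C1_gaussian_process M D g \<and> (AE \<omega> in M. \<forall>x\<in>D. div_on D (g \<omega>) x = 0)"

definition rotation_free2_process ::
  "'w measure \<Rightarrow> (real^2) set \<Rightarrow> ('w \<Rightarrow> real^2 \<Rightarrow> real^2) \<Rightarrow> bool" where
  "rotation_free2_process M D g \<longleftrightarrow>
    C1_gaussian_process M D g \<and> (AE \<omega> in M. \<forall>x\<in>D. curl2_on D (g \<omega>) x = 0)"

definition rotation_free3_process ::
  "'w measure \<Rightarrow> (real^3) set \<Rightarrow> ('w \<Rightarrow> real^3 \<Rightarrow> real^3) \<Rightarrow> bool" where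
  "rotation_free3_process M D g \<longleftrightarrow>
    C1_gaussian_process M D g \<and> (AE \<omega> in M. \<forall>x\<in>D. curl3_on D (g \<omega>) x = 0)"

end

theory Submission
  imports Defs
begin

text \<open>
  Let \<open>L\<close> be the divergence or a component of the curl, and fix an interior point \<open>x\<close>.  The
  difference quotients \<open>X n\<close> approximating \<open>L g x\<close> are finite linear combinations of values of \<open>g\<close>,
  hence Gaussian.  Their means and, for fixed \<open>m\<close>, the covariances of \<open>X n\<close> and \<open>X m\<close> are
  difference quotients of the mean and of the kernel columns, and tend to 0 with \<open>n\<close>.
  Characteristic functions avoid any uniform integrability argument: with \<open>\<phi>\<close> that of
  \<open>L g x\<close>, letting first \<open>n\<close> and then \<open>m\<close> tend to infinity in the characteristic
  function of the centred \<open>X n - X m\<close> gives \<open>1 = \<phi>\<^sup>2\<close>, so \<open>L g x = 0\<close> almost surely.  A countable dense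
  set of points \<open>x\<close> and continuity of the derivatives make the null set independent of \<open>x\<close>.
\<close>

section \<open>Limits of Gaussian random variables\<close>

lemma (in prob_space) gaussian_rv_square_integrable:
  assumes "gaussian_rv M X"
  shows "integrable M (\<lambda>\<omega>. (X \<omega>)\<^sup>2)"
proof -
  have [measurable]: "X \<in> borel_measurable M"
    using assms by (simp add: gaussian_rv_def)
  consider \<mu> \<sigma> where "\<sigma> > 0" "distributed M lborel X (\<lambda>t. ennreal (normal_density \<mu> \<sigma> t))"
    | \<mu> where "AE \<omega> in M. X \<omega> = \<mu>"
    using assms by (auto simp: gaussian_rv_def)
  then show ?thesis
  proof cases
    case 1
    have "integrable M (\<lambda>\<omega>. (X \<omega> - \<mu>)\<^sup>2)"
      using distributed_integrable[OF 1(2), of "\<lambda>x. (x - \<mu>)\<^sup>2"]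
        integrable_normal_moment[OF 1(1), of \<mu> 2] by simp
    moreover have "integrable M (\<lambda>\<omega>. X \<omega> - \<mu>)"
      using distributed_integrable[OF 1(2), of "\<lambda>x. x - \<mu>"]
        integrable_normal_moment[OF 1(1), of \<mu> 1] by simp
    \<comment> \<open>Expanding \<open>X\<close> squared around \<open>\<mu>\<close> leaves only the
      first two central moments.\<close>
    ultimately have "integrable M (\<lambda>\<omega>. (X \<omega> - \<mu>)\<^sup>2 + 2 * \<mu> * (X \<omega> - \<mu>) + \<mu>\<^sup>2)"
      by simp
    then show ?thesis
      by (rule back_subst[of "integrable M"]) (auto simp: power2_eq_square algebra_simps)
  next
    case 2
    show ?thesis
      by (rule integrable_cong_AE_imp[where g = "\<lambda>_. \<mu>\<^sup>2"]) (use 2 in auto)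
  qed
qed

lemma (in prob_space) gaussian_rv_integrable:
  assumes "gaussian_rv M X"
  shows "integrable M X"
proof (rule square_integrable_imp_integrable)
  show "X \<in> borel_measurable M"
    using assms by (simp add: gaussian_rv_def)
qed (rule gaussian_rv_square_integrable[OF assms])

text \<open>This is the real part of the characteristic function of the standard normal
  distribution.\<close>

lemma std_normal_cos:
  "(\<integral>x. std_normal_density x * cos (s * x) \<partial>lborel) = exp (- s\<^sup>2 / 2)"
proof -
  interpret N: real_distribution std_normal_distribution
    by (rule real_dist_normal_dist)
  have "exp (- s\<^sup>2 / 2) = Re (char std_normal_distribution s)"
    by (simp only: char_std_normal_distribution Re_complex_of_real)
  also have "\<dots> = (\<integral>x. Re (iexp (s * x)) \<partial>std_normal_distribution)"
    unfolding char_def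
    by (rule integral_Re[symmetric]) (intro N.integrable_iexp; simp)
  also have "\<dots> = (\<integral>x. std_normal_density x * cos (s * x) \<partial>lborel)"
    by (subst integral_density) (auto simp: Re_exp)
  finally show ?thesis by simp
qed

text \<open>A centred Gaussian is symmetric, so its characteristic function is real and the cosine
  carries all of it. Standardising turns the frequency \<open>t\<close> into
  \<open>t * \<sigma>\<close>; a point mass is the case of variance 0.\<close>

lemma (in prob_space) gaussian_rv_expectation_cos:
  assumes "gaussian_rv M X"
  shows "expectation (\<lambda>\<omega>. cos (t * (X \<omega> - expectation X))) = exp (- t\<^sup>2 * variance X / 2)"
proof -
  have [measurable]: "X \<in> borel_measurable M"
    using assms by (simp add: gaussian_rv_def)
  consider \<mu> \<sigma> where "\<sigma> > 0" "distributed M lborel X (\<lambda>t. ennreal (normal_density \<mu> \<sigma> t))"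
    | \<mu> where "AE \<omega> in M. X \<omega> = \<mu>"
    using assms by (auto simp: gaussian_rv_def)
  then show ?thesis
  proof cases
    case 1
    note ex = normal_distributed_expectation[OF 1] normal_distributed_variance[OF 1]
    have W: "distributed M lborel (\<lambda>x. (X x - \<mu>) / \<sigma>) std_normal_density"
      using normal_standard_normal_convert[OF 1(1), of X \<mu>] 1(2) by simp
    have "expectation (\<lambda>\<omega>. cos (t * (X \<omega> - \<mu>)))
        = expectation (\<lambda>\<omega>. cos (t * \<sigma> * ((X \<omega> - \<mu>) / \<sigma>)))"
      using 1(1) by simp
    also have "\<dots> = exp (- (t * \<sigma>)\<^sup>2 / 2)"
      by (subst distributed_integral[OF W, of "\<lambda>w. cos (t * \<sigma> * w)", symmetric])
         (simp_all add: std_normal_cos)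
    finally show ?thesis using ex by (simp add: power_mult_distrib)
  next
    case 2
    have e: "expectation X = \<mu>"
      using integral_cong_AE[of X M "\<lambda>_. \<mu>"] 2 by (simp add: prob_space)
    have "expectation (\<lambda>\<omega>. cos (t * (X \<omega> - \<mu>))) = expectation (\<lambda>_. 1)"
      by (rule integral_cong_AE) (use 2 in auto)
    moreover have "expectation (\<lambda>\<omega>. (X \<omega> - \<mu>)\<^sup>2) = expectation (\<lambda>_. 0)"
      by (rule integral_cong_AE) (use 2 in auto)
    ultimately show ?thesis by (simp add: e prob_space)
  qed
qed

text \<open>The product is dominated by the sum of the squares.\<close>

lemma integrable_mult_of_squares:
  fixes f g :: "'a \<Rightarrow> real"
  assumes [measurable]: "f \<in> borel_measurable M" "g \<in> borel_measurable M"
    and "integrable M (\<lambda>x. (f x)\<^sup>2)" "integrable M (\<lambda>x. (g x)\<^sup>2)"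
  shows "integrable M (\<lambda>x. f x * g x)"
proof (rule Bochner_Integration.integrable_bound)
  show "integrable M (\<lambda>x. (f x)\<^sup>2 + (g x)\<^sup>2)" using assms by simp
  have "\<bar>a * b\<bar> \<le> a\<^sup>2 + b\<^sup>2" for a b :: real
  proof -
    have "2 * \<bar>a * b\<bar> \<le> a\<^sup>2 + b\<^sup>2"
      using sum_squares_bound[of "\<bar>a\<bar>" "\<bar>b\<bar>"] by (simp add: abs_mult mult.assoc)
    then show ?thesis by linarith
  qed
  then show "AE x in M. norm (f x * g x) \<le> norm ((f x)\<^sup>2 + (g x)\<^sup>2)"
    by simp
qed simp

section \<open>Almost sure vanishing through characteristic functions\<close>

lemma (in prob_space) expectation_cos_tendsto:
  assumes "\<And>n. Z n \<in> borel_measurable M" "Y \<in> borel_measurable M"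
    and "\<And>\<omega>. \<omega> \<in> space M \<Longrightarrow> (\<lambda>n. Z n \<omega>) \<longlonglongrightarrow> Y \<omega>"
  shows "(\<lambda>n. expectation (\<lambda>\<omega>. cos (Z n \<omega> :: real))) \<longlonglongrightarrow> expectation (\<lambda>\<omega>. cos (Y \<omega>))"
\<comment> \<open>The cosine is bounded, so the constant 1 is a majorant whatever the moments of
  \<open>Z n\<close> and \<open>Y\<close> are.\<close>
proof (rule integral_dominated_convergence[where w = "\<lambda>_. 1"])
  show "AE \<omega> in M. (\<lambda>n. cos (Z n \<omega>)) \<longlonglongrightarrow> cos (Y \<omega>)"
    using assms(3) by (auto intro!: tendsto_cos)
qed (use assms in auto)

text \<open>Since \<open>1 - cos (t * Y \<omega>)\<close> is nonnegative with integral 0,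
  \<open>t * Y \<omega>\<close> is almost surely a multiple of \<open>2 * pi\<close>. Letting
  \<open>t\<close> run through the countably many values \<open>1 / real (Suc n)\<close> keeps a
  single null set, and small \<open>t\<close> leaves only the multiple 0.\<close>

lemma (in prob_space) AE_zero_of_expectation_cos:
  assumes [measurable]: "Y \<in> borel_measurable M"
    and cos1: "\<And>t. expectation (\<lambda>\<omega>. cos (t * Y \<omega>)) = 1"
  shows "AE \<omega> in M. Y \<omega> = (0::real)"
proof -
  have "AE \<omega> in M. cos (t * Y \<omega>) = 1" for t
  proof -
    have i: "integrable M (\<lambda>\<omega>. cos (t * Y \<omega>))"
      by (rule integrable_const_bound[where B = 1]) auto
    then have "expectation (\<lambda>\<omega>. 1 - cos (t * Y \<omega>)) = 0"
      by (simp add: prob_space cos1)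
    then have "AE \<omega> in M. 1 - cos (t * Y \<omega>) = 0"
      using i by (subst (asm) integral_nonneg_eq_0_iff_AE) auto
    then show ?thesis by eventually_elim simp
  qed
  then have "AE \<omega> in M. \<forall>n::nat. cos (1 / real (Suc n) * Y \<omega>) = 1"
    unfolding AE_all_countable by blast
  then show ?thesis
  proof eventually_elim
    fix \<omega> assume *: "\<forall>n::nat. cos (1 / real (Suc n) * Y \<omega>) = 1"
    \<comment> \<open>This \<open>n\<close> makes the argument \<open>u\<close> smaller than 1 in
      absolute value, hence smaller than one period.\<close>
    obtain n where n: "\<bar>Y \<omega>\<bar> < real n" using reals_Archimedean2 by blast
    define u where "u = 1 / real (Suc n) * Y \<omega>"
    have "\<bar>u\<bar> < 1" using n by (simp add: u_def abs_mult field_simps)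
    moreover obtain k :: int where "u = of_int k * 2 * pi"
      using *[rule_format, of n] cos_one_2pi_int[of u] unfolding u_def by blast
    ultimately have "\<bar>real_of_int k\<bar> * (2 * pi) < 1" by (simp add: abs_mult)
    moreover have "2 * pi > 1" using pi_gt3 by simp
    ultimately have "\<bar>real_of_int k\<bar> < 1"
      using mult_left_mono[of 1 "2 * pi" "\<bar>real_of_int k\<bar>"] by linarith
    then have "k = 0" by linarith
    then show "Y \<omega> = 0" using \<open>u = of_int k * 2 * pi\<close> by (simp add: u_def)
  qed
qed

text \<open>The covariance hypothesis is an iterated one, with \<open>m\<close> fixed, and gives no
  direct control of the variances \<open>c n n\<close>. These enter only through
  \<open>\<phi> n\<close>, which converges by dominated convergence.\<close>

lemma (in prob_space) gaussian_limit_zero: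
  fixes X :: "nat \<Rightarrow> 'a \<Rightarrow> real"
  assumes gauss: "\<And>n. gaussian_rv M (X n)"
    and gauss_diff: "\<And>n m. gaussian_rv M (\<lambda>\<omega>. X n \<omega> - X m \<omega>)"
    and lim: "\<And>\<omega>. \<omega> \<in> space M \<Longrightarrow> (\<lambda>n. X n \<omega>) \<longlonglongrightarrow> Y \<omega>"
    and mean: "(\<lambda>n. expectation (X n)) \<longlonglongrightarrow> 0"
    and cov: "\<And>m. (\<lambda>n. expectation (\<lambda>\<omega>. (X n \<omega> - expectation (X n)) * (X m \<omega> - expectation (X m))))
                \<longlonglongrightarrow> 0"
  shows "AE \<omega> in M. Y \<omega> = 0"
proof -
  have [measurable]: "X n \<in> borel_measurable M" for n
    using gauss by (simp add: gaussian_rv_def)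
  have [measurable]: "Y \<in> borel_measurable M"
    by (rule borel_measurable_LIMSEQ_real[of _ X]) (use lim in auto)
  have [simp]: "integrable M (X n)" for n
    using gauss by (rule gaussian_rv_integrable)
  define Z where "Z n \<omega> = X n \<omega> - expectation (X n)" for n \<omega>
  define c where "c n m = expectation (\<lambda>\<omega>. Z n \<omega> * Z m \<omega>)" for n m
  have [measurable]: "Z n \<in> borel_measurable M" for n
    unfolding Z_def by measurable
  have Z_sq: "integrable M (\<lambda>\<omega>. (Z n \<omega>)\<^sup>2)" for n
    unfolding Z_def power2_diff using gaussian_rv_square_integrable[OF gauss, of n] by auto
  have [simp]: "integrable M (\<lambda>\<omega>. Z n \<omega> * Z m \<omega>)" for n m
    by (rule integrable_mult_of_squares) (auto intro: Z_sq)
  \<comment> \<open>The means tend to 0, so centring does not change the pointwise limit.\<close>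
  have Z_lim: "(\<lambda>n. Z n \<omega>) \<longlonglongrightarrow> Y \<omega>" if "\<omega> \<in> space M" for \<omega>
    using tendsto_diff[OF lim[OF that] mean] by (simp add: Z_def)
  have c_lim: "(\<lambda>n. c n m) \<longlonglongrightarrow> 0" for m
    using cov[of m] by (simp add: c_def Z_def)
  show ?thesis
  proof (rule AE_zero_of_expectation_cos)
    fix t :: real
    define \<phi> where "\<phi> n = expectation (\<lambda>\<omega>. cos (t * Z n \<omega>))" for n
    define \<psi> where "\<psi> = expectation (\<lambda>\<omega>. cos (t * Y \<omega>))"
    have \<phi>: "\<phi> n = exp (- t\<^sup>2 * c n n / 2)" for n
      using gaussian_rv_expectation_cos[OF gauss, of t n]
      by (simp add: \<phi>_def c_def Z_def power2_eq_square)
    have \<phi>_lim: "\<phi> \<longlonglongrightarrow> \<psi>"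
      unfolding \<phi>_def \<psi>_def
      by (rule expectation_cos_tendsto) (auto intro!: tendsto_intros Z_lim)
    \<comment> \<open>The variance of \<open>Z n - Z m\<close> is
      \<open>c n n + c m m - 2 * c n m\<close>. Under the exponential the diagonal terms become
      \<open>\<phi> n * \<phi> m\<close>, and the covariance becomes a separate factor.\<close>
    have diff: "expectation (\<lambda>\<omega>. cos (t * (Z n \<omega> - Z m \<omega>))) = \<phi> n * \<phi> m * exp (t\<^sup>2 * c n m)"
      for n m
    proof -
      have e: "X n \<omega> - X m \<omega> - expectation (\<lambda>\<omega>. X n \<omega> - X m \<omega>) = Z n \<omega> - Z m \<omega>" for \<omega>
        by (simp add: Z_def)
      have "expectation (\<lambda>\<omega>. (Z n \<omega> - Z m \<omega>)\<^sup>2)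
          = expectation (\<lambda>\<omega>. Z n \<omega> * Z n \<omega> + Z m \<omega> * Z m \<omega> - 2 * (Z n \<omega> * Z m \<omega>))"
        by (simp add: power2_eq_square algebra_simps)
      also have "\<dots> = c n n + c m m - 2 * c n m"
        by (simp add: c_def)
      finally show ?thesis
        using gaussian_rv_expectation_cos[OF gauss_diff, of t n m, unfolded e]
        by (simp add: \<phi> flip: exp_add) (simp add: algebra_simps diff_divide_distrib add_divide_distrib)
    qed
    \<comment> \<open>As \<open>n\<close> grows with \<open>m\<close> fixed, the covariance factor
      tends to \<open>exp 0 = 1\<close>.\<close>
    have "expectation (\<lambda>\<omega>. cos (t * (Y \<omega> - Z m \<omega>))) = \<psi> * \<phi> m" for m
    proof (rule LIMSEQ_unique)
      show "(\<lambda>n. expectation (\<lambda>\<omega>. cos (t * (Z n \<omega> - Z m \<omega>))))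
          \<longlonglongrightarrow> expectation (\<lambda>\<omega>. cos (t * (Y \<omega> - Z m \<omega>)))"
        by (rule expectation_cos_tendsto) (auto intro!: tendsto_intros Z_lim)
      have "(\<lambda>n. \<phi> n * \<phi> m * exp (t\<^sup>2 * c n m)) \<longlonglongrightarrow> \<psi> * \<phi> m * exp (t\<^sup>2 * 0)"
        by (intro tendsto_intros \<phi>_lim c_lim)
      then show "(\<lambda>n. expectation (\<lambda>\<omega>. cos (t * (Z n \<omega> - Z m \<omega>)))) \<longlonglongrightarrow> \<psi> * \<phi> m"
        by (simp add: diff)
    qed
    \<comment> \<open>Now \<open>m\<close> grows as well; the limiting integrand is
      \<open>cos 0 = 1\<close>.\<close>
    moreover have "(\<lambda>m. expectation (\<lambda>\<omega>. cos (t * (Y \<omega> - Z m \<omega>))))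
        \<longlonglongrightarrow> expectation (\<lambda>\<omega>. cos (t * (Y \<omega> - Y \<omega>)))"
      by (rule expectation_cos_tendsto, measurable, intro tendsto_intros Z_lim)
    ultimately have "(\<lambda>m. \<psi> * \<phi> m) \<longlonglongrightarrow> 1"
      by (simp add: prob_space)
    moreover have "(\<lambda>m. \<psi> * \<phi> m) \<longlonglongrightarrow> \<psi> * \<psi>"
      by (intro tendsto_intros \<phi>_lim)
    ultimately have "\<psi> * \<psi> = 1" by (rule LIMSEQ_unique[symmetric])
    \<comment> \<open>The sign excludes the root -1: \<open>\<psi>\<close> is a limit of
      exponentials.\<close>
    moreover have "\<psi> \<ge> 0"
      by (rule LIMSEQ_le_const[OF \<phi>_lim]) (simp add: \<phi>)
    ultimately show "expectation (\<lambda>\<omega>. cos (t * Y \<omega>)) = 1"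
      by (metis \<psi>_def abs_of_nonneg power2_eq_square real_sqrt_abs real_sqrt_one)
  qed simp
qed

section \<open>Finite linear functionals of a Gaussian process\<close>

text \<open>These are exactly the linear combinations that occur in the definition of joint
  Gaussianity. Taking an arbitrary field \<open>v\<close> as argument allows the same functional to
  act on paths, on the mean and on kernel columns.\<close>

definition point_functional :: "'p set \<Rightarrow> (('p \<Rightarrow> real^'d) \<Rightarrow> real) \<Rightarrow> bool" where
  "point_functional D F \<longleftrightarrow>
    (\<exists>S c. finite S \<and> S \<subseteq> D \<and> (\<forall>v. F v = (\<Sum>p\<in>S. c p \<bullet> v p)))"

lemma point_functionalE:
  assumes "point_functional D F"
  obtains S c where "finite S" "S \<subseteq> D" "\<And>v. F v = (\<Sum>p\<in>S. c p \<bullet> v p)"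
  using assms by (auto simp: point_functional_def)

lemma point_functional_eval:
  assumes "p \<in> D"
  shows "point_functional D (\<lambda>v. v p $ i)"
  unfolding point_functional_def
  by (rule exI[of _ "{p}"], rule exI[of _ "\<lambda>_. axis i 1"])
     (use assms in \<open>simp add: inner_axis'\<close>)

lemma point_functional_scale:
  assumes "point_functional D F"
  shows "point_functional D (\<lambda>v. a * F v)"
proof -
  obtain S c where "finite S" "S \<subseteq> D" "\<And>v. F v = (\<Sum>p\<in>S. c p \<bullet> v p)"
    using assms by (rule point_functionalE) blast
  then show ?thesis
    unfolding point_functional_def
    by (intro exI[of _ S] exI[of _ "\<lambda>p. a *\<^sub>R c p"]) (simp add: sum_distrib_left)
qed

lemma point_functional_add:
  assumes "point_functional D F" "point_functional D G"
  shows "point_functional D (\<lambda>v. F v + G v)"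
proof -
  obtain S c where S: "finite S" "S \<subseteq> D" "\<And>v. F v = (\<Sum>p\<in>S. c p \<bullet> v p)"
    using assms(1) by (rule point_functionalE) blast
  obtain T d where T: "finite T" "T \<subseteq> D" "\<And>v. G v = (\<Sum>p\<in>T. d p \<bullet> v p)"
    using assms(2) by (rule point_functionalE) blast
  \<comment> \<open>The supports \<open>S\<close> and \<open>T\<close> may differ or overlap, so
    both coefficient families are extended by 0 to the union and added there.\<close>
  define e where "e p = (if p \<in> S then c p else 0) + (if p \<in> T then d p else 0)" for p
  have "F v + G v = (\<Sum>p\<in>S \<union> T. e p \<bullet> v p)" for v
  proof -
    have "F v = (\<Sum>p\<in>S \<union> T. (if p \<in> S then c p else 0) \<bullet> v p)"
      unfolding S(3) using S(1) T(1) by (intro sum.mono_neutral_cong_left) auto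
    moreover have "G v = (\<Sum>p\<in>S \<union> T. (if p \<in> T then d p else 0) \<bullet> v p)"
      unfolding T(3) using S(1) T(1) by (intro sum.mono_neutral_cong_left) auto
    ultimately show ?thesis
      by (simp only: e_def inner_add_left sum.distrib)
  qed
  then show ?thesis
    unfolding point_functional_def using S T by (intro exI[of _ "S \<union> T"] exI[of _ e]) auto
qed

lemma point_functional_diff:
  assumes "point_functional D F" "point_functional D G"
  shows "point_functional D (\<lambda>v. F v - G v)"
  using point_functional_add[OF assms(1) point_functional_scale[OF assms(2), of "-1"]] by simp

lemma point_functional_sum:
  assumes "\<And>i. i \<in> I \<Longrightarrow> point_functional D (F i)"
  shows "point_functional D (\<lambda>v. \<Sum>i\<in>I. F i v)"
proof -
  have "point_functional D (\<lambda>v. 0)"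
    unfolding point_functional_def by (intro exI[of _ "{}"]) auto
  then show ?thesis using assms
    by (induction I rule: infinite_finite_induct) (auto intro: point_functional_add)
qed

text \<open>The entries may be vectors themselves, so two applications cover matrix-valued
  integrands such as that of \<open>gp_cov\<close>.\<close>

lemma integrable_vecI:
  fixes f :: "'a \<Rightarrow> 'b::euclidean_space ^ 'n"
  assumes "\<And>i. integrable M (\<lambda>\<omega>. f \<omega> $ i)"
  shows "integrable M f"
proof -
  have "integrable M (\<lambda>\<omega>. f \<omega> \<bullet> b)" if "b \<in> Basis" for b
    using that assms by (auto simp: Basis_vec_def inner_axis)
  then have "integrable M (\<lambda>\<omega>. \<Sum>b\<in>Basis. (f \<omega> \<bullet> b) *\<^sub>R b)"
    by (intro Bochner_Integration.integrable_sum integrable_scaleR_left)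
  then show ?thesis by (simp add: euclidean_representation)
qed

section \<open>Mean and covariance under point functionals\<close>

context prob_space
begin

lemma gaussian_point_functional:
  assumes "gaussian_process M D g" "point_functional D F"
  shows "gaussian_rv M (\<lambda>\<omega>. F (g \<omega>))"
proof -
  obtain S c where S: "finite S" "S \<subseteq> D" "\<And>v. F v = (\<Sum>p\<in>S. c p \<bullet> v p)"
    using assms(2) by (rule point_functionalE) blast
  then show ?thesis
    using assms(1) by (simp add: gaussian_process_def jointly_gaussian_def)
qed

lemma gaussian_process_component:
  assumes "gaussian_process M D g" "p \<in> D"
  shows "gaussian_rv M (\<lambda>\<omega>. g \<omega> p $ i)"
  using gaussian_point_functional[OF assms(1) point_functional_eval[OF assms(2)]] .

text \<open>Coordinate projections are bounded linear and commute with the Bochner integral once the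
  vector itself is integrable.\<close>

lemma gp_mean_component:
  assumes "gaussian_process M D g" "p \<in> D"
  shows "gp_mean M g p $ i = expectation (\<lambda>\<omega>. g \<omega> p $ i)"
proof -
  have "integrable M (\<lambda>\<omega>. g \<omega> p)"
    by (intro integrable_vecI gaussian_rv_integrable gaussian_process_component[OF assms])
  then show ?thesis
    unfolding gp_mean_def
    by (simp add: integral_bounded_linear[OF bounded_linear_vec_nth, symmetric])
qed

lemma integrable_centered_product:
  assumes "gaussian_process M D g" "p \<in> D" "q \<in> D"
  shows "integrable M (\<lambda>\<omega>. (g \<omega> p - a) $ i * (g \<omega> q - b) $ j)"
proof -
  have c: "(\<lambda>\<omega>. (g \<omega> p - a) $ i) \<in> borel_measurable M"
    "integrable M (\<lambda>\<omega>. ((g \<omega> p - a) $ i)\<^sup>2)" if "p \<in> D" for p i a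
  proof -
    note gc = gaussian_process_component[OF assms(1) that, of i]
    then have [measurable]: "(\<lambda>\<omega>. g \<omega> p $ i) \<in> borel_measurable M"
      by (simp add: gaussian_rv_def)
    show "(\<lambda>\<omega>. (g \<omega> p - a) $ i) \<in> borel_measurable M"
      unfolding vector_minus_component by measurable
    show "integrable M (\<lambda>\<omega>. ((g \<omega> p - a) $ i)\<^sup>2)"
      unfolding vector_minus_component power2_diff
      using gaussian_rv_square_integrable[OF gc] gaussian_rv_integrable[OF gc] by auto
  qed
  show ?thesis
    by (intro integrable_mult_of_squares c assms)
qed

lemma gp_cov_component:
  assumes "gaussian_process M D g" "p \<in> D" "q \<in> D"
  shows "gp_cov M g p q $ i $ j
    = expectation (\<lambda>\<omega>. (g \<omega> p - gp_mean M g p) $ i * (g \<omega> q - gp_mean M g q) $ j)"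
proof -
  let ?f = "\<lambda>\<omega>. (\<chi> i j. (g \<omega> p - gp_mean M g p) $ i * (g \<omega> q - gp_mean M g q) $ j) :: real^'b^'b"
  \<comment> \<open>The matrix integral is projected twice, first to a row and then to an entry, and
    each projection needs integrability.\<close>
  have int: "integrable M ?f" "integrable M (\<lambda>\<omega>. ?f \<omega> $ i)"
    using integrable_centered_product[OF assms] by (intro integrable_vecI; simp)+
  have "integral\<^sup>L M ?f $ i $ j = integral\<^sup>L M (\<lambda>\<omega>. ?f \<omega> $ i) $ j"
    by (simp only: integral_bounded_linear[OF bounded_linear_vec_nth int(1), symmetric])
  also have "\<dots> = integral\<^sup>L M (\<lambda>\<omega>. ?f \<omega> $ i $ j)"
    by (simp only: integral_bounded_linear[OF bounded_linear_vec_nth int(2), symmetric])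
  finally show ?thesis by (simp add: gp_cov_def)
qed

text \<open>By linearity, the mean of a difference quotient of the paths is the same difference
  quotient of the mean field.\<close>

lemma expectation_point_functional:
  assumes "gaussian_process M D g" "point_functional D F"
  shows "expectation (\<lambda>\<omega>. F (g \<omega>)) = F (gp_mean M g)"
proof -
  obtain S c where S: "finite S" "S \<subseteq> D" "\<And>v. F v = (\<Sum>p\<in>S. c p \<bullet> v p)"
    using assms(2) by (rule point_functionalE) blast
  have [simp]: "integrable M (\<lambda>\<omega>. g \<omega> p $ i)" if "p \<in> S" for p i
    using gaussian_rv_integrable[OF gaussian_process_component[OF assms(1)]] that S(2) by auto
  have "expectation (\<lambda>\<omega>. F (g \<omega>)) = (\<Sum>p\<in>S. \<Sum>i\<in>UNIV. c p $ i * expectation (\<lambda>\<omega>. g \<omega> p $ i))"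
    by (simp add: S(3) inner_vec_def)
  also have "\<dots> = F (gp_mean M g)"
    unfolding S(3) inner_vec_def using S(2)
    by (intro sum.cong) (auto simp: gp_mean_component[OF assms(1)])
  finally show ?thesis .
qed

text \<open>By linearity \<open>F\<close> passes into the first argument of the kernel while
  \<open>q\<close> stays fixed. This produces the columns on which the differential hypotheses are
  imposed.\<close>

lemma covariance_point_functional_component:
  assumes "gaussian_process M D g" "point_functional D F" "q \<in> D"
  shows "integrable M (\<lambda>\<omega>. (F (g \<omega>) - F (gp_mean M g)) * (g \<omega> q - gp_mean M g q) $ j)" (is ?int)
    and "expectation (\<lambda>\<omega>. (F (g \<omega>) - F (gp_mean M g)) * (g \<omega> q - gp_mean M g q) $ j)
      = F (\<lambda>p. column j (gp_cov M g p q))" (is ?ex)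
proof -
  obtain S c where S: "finite S" "S \<subseteq> D" "\<And>v. F v = (\<Sum>p\<in>S. c p \<bullet> v p)"
    using assms(2) by (rule point_functionalE) blast
  have int: "integrable M (\<lambda>\<omega>. (g \<omega> p - gp_mean M g p) $ i * (g \<omega> q - gp_mean M g q) $ j)"
    if "p \<in> S" for p i
    using integrable_centered_product[OF assms(1) _ assms(3)] that S(2) by blast
  have e: "(F (g \<omega>) - F (gp_mean M g)) * (g \<omega> q - gp_mean M g q) $ j
    = (\<Sum>p\<in>S. \<Sum>i\<in>UNIV. c p $ i * ((g \<omega> p - gp_mean M g p) $ i * (g \<omega> q - gp_mean M g q) $ j))"
    for \<omega>
    by (simp only: S(3) inner_diff_right[symmetric] sum_subtractf[symmetric])
       (simp only: inner_vec_def sum_distrib_right inner_real_def mult.assoc)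
  show ?int
    unfolding e by (intro Bochner_Integration.integrable_sum integrable_mult_right int)
  have "expectation (\<lambda>\<omega>. (F (g \<omega>) - F (gp_mean M g)) * (g \<omega> q - gp_mean M g q) $ j)
    = (\<Sum>p\<in>S. \<Sum>i\<in>UNIV. c p $ i
         * expectation (\<lambda>\<omega>. (g \<omega> p - gp_mean M g p) $ i * (g \<omega> q - gp_mean M g q) $ j))"
    unfolding e
    by (subst Bochner_Integration.integral_sum, (intro Bochner_Integration.integrable_sum integrable_mult_right int; simp),
        intro sum.cong refl,
        subst Bochner_Integration.integral_sum, (intro integrable_mult_right int; simp), simp)
  also have "\<dots> = F (\<lambda>p. column j (gp_cov M g p q))"
    unfolding S(3) inner_vec_def using S(2) assms(3)
    by (intro sum.cong) (auto simp: gp_cov_component[OF assms(1)] column_def)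
  finally show ?ex .
qed

text \<open>\<open>G\<close> sees only finitely many points \<open>q\<close>, so the covariance is a
  finite combination, with coefficients independent of \<open>n\<close>, of the values of
  \<open>F n\<close> on kernel columns. Convergence for each \<open>q\<close> and \<open>j\<close>
  separately is enough.\<close>

lemma covariance_tendsto_zero:
  assumes g: "gaussian_process M D g"
    and F: "\<And>n. point_functional D (F n)" and G: "point_functional D G"
    and lim: "\<And>q j. q \<in> D \<Longrightarrow> (\<lambda>n. F n (\<lambda>p. column j (gp_cov M g p q))) \<longlonglongrightarrow> 0"
  shows "(\<lambda>n. expectation (\<lambda>\<omega>. (F n (g \<omega>) - F n (gp_mean M g)) * (G (g \<omega>) - G (gp_mean M g))))
    \<longlonglongrightarrow> (0::real)"
proof -
  obtain T d where T: "finite T" "T \<subseteq> D" "\<And>v. G v = (\<Sum>q\<in>T. d q \<bullet> v q)"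
    using G by (rule point_functionalE) blast
  have e: "(F n (g \<omega>) - F n (gp_mean M g)) * (G (g \<omega>) - G (gp_mean M g))
    = (\<Sum>q\<in>T. \<Sum>j\<in>UNIV. d q $ j * ((F n (g \<omega>) - F n (gp_mean M g)) * (g \<omega> q - gp_mean M g q) $ j))"
    for n \<omega>
    by (simp only: T(3) inner_diff_right[symmetric] sum_subtractf[symmetric])
       (simp only: inner_vec_def sum_distrib_left inner_real_def mult.left_commute)
  have int: "integrable M (\<lambda>\<omega>. (F n (g \<omega>) - F n (gp_mean M g)) * (g \<omega> q - gp_mean M g q) $ j)"
    if "q \<in> T" for n q j
    using covariance_point_functional_component(1)[OF g F] that T(2) by blast
  have "expectation (\<lambda>\<omega>. (F n (g \<omega>) - F n (gp_mean M g)) * (G (g \<omega>) - G (gp_mean M g)))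
      = (\<Sum>q\<in>T. \<Sum>j\<in>UNIV. d q $ j
          * expectation (\<lambda>\<omega>. (F n (g \<omega>) - F n (gp_mean M g)) * (g \<omega> q - gp_mean M g q) $ j))" for n
    unfolding e
    by (subst Bochner_Integration.integral_sum, (intro Bochner_Integration.integrable_sum integrable_mult_right int; simp),
        intro sum.cong refl,
        subst Bochner_Integration.integral_sum, (intro integrable_mult_right int; simp), simp)
  also have "\<dots> n = (\<Sum>q\<in>T. \<Sum>j\<in>UNIV. d q $ j * F n (\<lambda>p. column j (gp_cov M g p q)))" for n
    using T(2) by (intro sum.cong refl arg_cong2[where f = "(*)"] covariance_point_functional_component(2)[OF g F]) auto
  finally have "expectation (\<lambda>\<omega>. (F n (g \<omega>) - F n (gp_mean M g)) * (G (g \<omega>) - G (gp_mean M g)))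
      = (\<Sum>q\<in>T. \<Sum>j\<in>UNIV. d q $ j * F n (\<lambda>p. column j (gp_cov M g p q)))" for n .
  moreover have "(\<lambda>n. \<Sum>q\<in>T. \<Sum>j\<in>UNIV. d q $ j * F n (\<lambda>p. column j (gp_cov M g p q)))
      \<longlonglongrightarrow> (\<Sum>q\<in>T. \<Sum>j\<in>UNIV. d q $ j * 0)"
    using T(2) by (intro tendsto_intros lim) auto
  ultimately show ?thesis by simp
qed

end

section \<open>First-order differential operators with constant coefficients\<close>

text \<open>A common form for the divergence and every curl component, so that the probabilistic
  argument is carried out once.\<close>

definition first_order_op ::
  "('d \<Rightarrow> 'd \<Rightarrow> real) \<Rightarrow> (real^'d) set \<Rightarrow> (real^'d \<Rightarrow> real^'d) \<Rightarrow> real^'d \<Rightarrow> real" where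
  "first_order_op A D v x = (\<Sum>i\<in>UNIV. \<Sum>k\<in>UNIV. A i k * partial_on D k v i x)"

text \<open>Forward difference quotients, with a common step \<open>h\<close> in all directions. The
  factor \<open>1 / h\<close> stands in front to match
  \<open>point_functional_scale\<close>.\<close>

definition difference_op ::
  "('d \<Rightarrow> 'd \<Rightarrow> real) \<Rightarrow> real^'d \<Rightarrow> real \<Rightarrow> (real^'d \<Rightarrow> real^'d) \<Rightarrow> real" where
  "difference_op A x h v
    = (\<Sum>i\<in>UNIV. \<Sum>k\<in>UNIV. A i k * (1 / h * (v (x + h *\<^sub>R axis k 1) $ i - v x $ i)))"

lemma difference_op_tendsto:
  assumes "v differentiable (at x)" "x \<in> interior D"
    and h: "h \<longlonglongrightarrow> 0" "\<And>n. h n \<noteq> 0"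
  shows "(\<lambda>n. difference_op A x (h n) v) \<longlonglongrightarrow> first_order_op A D v x"
proof -
  have "(\<lambda>n. 1 / h n * (v (x + h n *\<^sub>R axis k 1) $ i - v x $ i)) \<longlonglongrightarrow> partial_on D k v i x" for i k
  proof -
    \<comment> \<open>The base point is written as the value at 0 of the line through
      \<open>x\<close> in direction \<open>k\<close>, ready for the chain rule.\<close>
    have "(v has_derivative (\<lambda>u. jacobian v (at x) *v u)) (at (x + 0 *\<^sub>R axis k 1))"
      using assms(1) by (simp add: jacobian_works)
    then have "((\<lambda>s. v (x + s *\<^sub>R axis k 1)) has_derivative
        (\<lambda>s. jacobian v (at x) *v (s *\<^sub>R axis k 1))) (at 0)"
      by (rule has_derivative_compose[rotated]) (auto intro!: derivative_eq_intros)
    then have "((\<lambda>s. v (x + s *\<^sub>R axis k 1) $ i) has_derivative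
        (\<lambda>s. (jacobian v (at x) *v (s *\<^sub>R axis k 1)) $ i)) (at 0)"
      by (rule bounded_linear.has_derivative[OF bounded_linear_vec_nth])
    then have "((\<lambda>s. v (x + s *\<^sub>R axis k 1) $ i) has_field_derivative jacobian v (at x) $ i $ k) (at 0)"
      unfolding has_field_derivative_def
      by (rule has_derivative_eq_rhs)
         (auto simp: matrix_vector_mult_scaleR matrix_vector_mult_basis column_def)
    then have "((\<lambda>s. (v (x + s *\<^sub>R axis k 1) $ i - v x $ i) / s) \<longlongrightarrow> jacobian v (at x) $ i $ k) (at 0)"
      by (simp add: DERIV_def)
    \<comment> \<open>The filter \<open>at 0\<close> is punctured, hence the requirement that the
      steps be nonzero.\<close>
    moreover have "filterlim h (at 0) sequentially"
      using h by (auto simp: filterlim_at)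
    ultimately have "(\<lambda>n. (v (x + h n *\<^sub>R axis k 1) $ i - v x $ i) / h n) \<longlonglongrightarrow> jacobian v (at x) $ i $ k"
      by (rule filterlim_compose)
    then show ?thesis
      using assms(2) by (simp add: partial_on_def jacobian_on_def)
  qed
  then show ?thesis
    unfolding difference_op_def first_order_op_def by (intro tendsto_intros)
qed

lemma point_functional_difference_op:
  assumes "x \<in> D" "\<And>k. x + h *\<^sub>R axis k 1 \<in> D"
  shows "point_functional D (difference_op A x h)"
  unfolding difference_op_def
  by (intro point_functional_sum point_functional_scale point_functional_diff
      point_functional_eval assms)

text \<open>The axis vectors have norm 1, so a step bounded by the radius of a ball inside
  \<open>D\<close> serves all directions at once.\<close>

lemma interior_null_sequence:
  assumes "x \<in> interior D"
  obtains h :: "nat \<Rightarrow> real" where "h \<longlonglongrightarrow> 0" "\<And>n. h n \<noteq> 0"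
    "\<And>n k. x + h n *\<^sub>R axis k 1 \<in> (D :: (real^'d) set)"
proof -
  obtain e where e: "e > 0" "cball x e \<subseteq> D"
    using assms by (auto simp: mem_interior_cball)
  \<comment> \<open>\<open>Suc n\<close> keeps the first step from being the default value of a
    division by 0.\<close>
  define h where "h n = e / real (Suc n)" for n
  show ?thesis
  proof
    show "h \<longlonglongrightarrow> 0"
      unfolding h_def
      by (rule LIMSEQ_Suc) (rule lim_const_over_n)
    show "h n \<noteq> 0" for n using e by (simp add: h_def)
    show "x + h n *\<^sub>R axis k 1 \<in> D" for n k
    proof -
      have "h n \<le> e" "0 \<le> h n" using e(1) by (auto simp: h_def field_simps)
      then have "x + h n *\<^sub>R axis k 1 \<in> cball x e"
        by (simp add: dist_norm norm_axis_1)
      then show ?thesis using e(2) by blast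
    qed
  qed
qed

section \<open>Passage from single interior points to whole paths\<close>

lemma first_order_op_zero_extend:
  assumes "C1_field_on D v" "T \<subseteq> interior D" "interior D \<subseteq> closure T"
    and zero: "\<And>x. x \<in> T \<Longrightarrow> first_order_op A D v x = 0"
  shows "first_order_op A D v x = 0"
proof (cases "x \<in> closure (interior D)")
  case True
  have cl: "closure T = closure (interior D)"
    using assms(2,3) by (metis closure_closure closure_mono subset_antisym)
  have "continuous_on (closure (interior D)) (jacobian_on D v)"
    using assms(1) by (simp add: C1_field_on_def)
  then have "continuous_on (closure T) (first_order_op A D v)"
    unfolding first_order_op_def partial_on_def cl
    by (intro continuous_intros)
  then show ?thesis
    by (rule continuous_constant_on_closure) (use zero True cl in auto)
next
  case False
  \<comment> \<open>Away from the closure of the interior the Jacobian has its default value 0, so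
    every first-order operator vanishes.\<close>
  then have "x \<notin> interior D" using closure_subset by blast
  with False show ?thesis
    by (simp add: first_order_op_def partial_on_def jacobian_on_def)
qed

text \<open>At an interior point short difference quotients use only points of \<open>D\<close>, so
  they are point functionals of the process. The remaining points are reached path by path through
  \<open>first_order_op_zero_extend\<close>.\<close>

lemma (in prob_space) first_order_op_gaussian_process_zero:
  assumes "C1_gaussian_process M D g"
    and m: "C1_field_on D (gp_mean M g)" "\<And>x. x \<in> D \<Longrightarrow> first_order_op A D (gp_mean M g) x = 0"
    and K: "\<And>q j. q \<in> D \<Longrightarrow> C1_field_on D (\<lambda>p. column j (gp_cov M g p q))"
      "\<And>q j x. q \<in> D \<Longrightarrow> x \<in> D \<Longrightarrow> first_order_op A D (\<lambda>p. column j (gp_cov M g p q)) x = 0"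
  shows "AE \<omega> in M. \<forall>x. first_order_op A D (g \<omega>) x = 0"
proof -
  have g: "gaussian_process M D g" and C1: "\<And>\<omega>. \<omega> \<in> space M \<Longrightarrow> C1_field_on D (g \<omega>)"
    using assms(1) by (auto simp: C1_gaussian_process_def)
  have pointwise: "AE \<omega> in M. first_order_op A D (g \<omega>) x = 0" if x: "x \<in> interior D" for x
  proof -
    have xD: "x \<in> D" using x interior_subset by blast
    obtain h :: "nat \<Rightarrow> real" where h: "h \<longlonglongrightarrow> 0" "\<And>n. h n \<noteq> 0"
      "\<And>n k. x + h n *\<^sub>R axis k 1 \<in> D"
      using interior_null_sequence[OF x] by blast
    have F: "point_functional D (difference_op A x (h n))" for n
      by (rule point_functional_difference_op[OF xD h(3)])
    have lim: "(\<lambda>n. difference_op A x (h n) v) \<longlonglongrightarrow> first_order_op A D v x"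
      if "C1_field_on D v" for v
      using that x h(1,2) by (intro difference_op_tendsto) (auto simp: C1_field_on_def)
    note ex = expectation_point_functional[OF g F]
    show ?thesis
    \<comment> \<open>Unfolding \<open>ex\<close> replaces the expectations of the quotients by
      quotients of the mean field, the form in which \<open>covariance_tendsto_zero\<close> is
      stated.\<close>
    proof (rule gaussian_limit_zero[where X = "\<lambda>n \<omega>. difference_op A x (h n) (g \<omega>)"], unfold ex)
      show "gaussian_rv M (\<lambda>\<omega>. difference_op A x (h n) (g \<omega>))" for n
        by (rule gaussian_point_functional[OF g F])
      show "gaussian_rv M (\<lambda>\<omega>. difference_op A x (h n) (g \<omega>) - difference_op A x (h m) (g \<omega>))" for n m
        by (rule gaussian_point_functional[OF g point_functional_diff[OF F F]])
      show "(\<lambda>n. difference_op A x (h n) (g \<omega>)) \<longlonglongrightarrow> first_order_op A D (g \<omega>) x"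
        if "\<omega> \<in> space M" for \<omega>
        using lim[OF C1[OF that]] .
      show "(\<lambda>n. difference_op A x (h n) (gp_mean M g)) \<longlonglongrightarrow> 0"
        using lim[OF m(1)] m(2)[OF xD] by simp
      show "(\<lambda>n. expectation (\<lambda>\<omega>.
            (difference_op A x (h n) (g \<omega>) - difference_op A x (h n) (gp_mean M g)) *
            (difference_op A x (h m) (g \<omega>) - difference_op A x (h m) (gp_mean M g)))) \<longlonglongrightarrow> 0" for m
        using covariance_tendsto_zero[OF g F F] lim[OF K(1)] K(2)[OF _ xD] by simp
    qed
  qed
  \<comment> \<open>The exceptional set of \<open>pointwise\<close> depends on \<open>x\<close>;
    countability of \<open>T\<close> makes the union of these sets null.\<close>
  obtain T where T: "countable T" "T \<subseteq> interior D" "interior D \<subseteq> closure T"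
    by (rule separable)
  have "AE \<omega> in M. \<forall>x\<in>T. first_order_op A D (g \<omega>) x = 0"
    by (rule AE_ball_countable'[OF pointwise T(1)]) (use T(2) in blast)
  then show ?thesis
    using AE_space
  proof eventually_elim
    case (elim \<omega>)
    then show ?case
      using first_order_op_zero_extend[OF C1 T(2,3)] by blast
  qed
qed

section \<open>Divergence and curl as first-order operators\<close>

lemma div_on_first_order: "div_on D v x = first_order_op (\<lambda>i k. if i = k then 1 else 0) D v x"
  by (simp add: div_on_def first_order_op_def if_distrib[of "\<lambda>a. a * _"] cong: if_cong)

text \<open>The skew-symmetric coefficient matrix of the rotation in the coordinate plane of
  \<open>a\<close> and \<open>b\<close>; row indices are components, column indices are
  directions.\<close>

definition rot_coeff :: "'d \<Rightarrow> 'd \<Rightarrow> 'd \<Rightarrow> 'd \<Rightarrow> real" where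
  "rot_coeff a b i k = of_bool (i = b \<and> k = a) - of_bool (i = a \<and> k = b)"

lemma first_order_op_rot_coeff:
  "first_order_op (rot_coeff a b) D v x = partial_on D a v b x - partial_on D b v a x"
proof -
  have "(\<Sum>i\<in>UNIV. \<Sum>k\<in>UNIV. of_bool (i = p \<and> k = q) * partial_on D k v i x) = partial_on D q v p x"
    for p q
    by (simp add: of_bool_conj mult.assoc flip: sum_distrib_left)
  then show ?thesis
    by (simp add: first_order_op_def rot_coeff_def left_diff_distrib sum_subtractf)
qed

lemma curl2_on_first_order: "curl2_on D v x = first_order_op (rot_coeff 1 2) D v x"
  by (simp add: curl2_on_def first_order_op_rot_coeff)

text \<open>Splits the vector equation into three scalar operators, to each of which the result for
  first-order operators applies.\<close>

lemma curl3_on_eq_0_iff: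
  "curl3_on D v x = 0 \<longleftrightarrow>
    first_order_op (rot_coeff 2 3) D v x = 0 \<and>
    first_order_op (rot_coeff 3 1) D v x = 0 \<and>
    first_order_op (rot_coeff 1 2) D v x = 0"
  by (simp add: curl3_on_def first_order_op_rot_coeff vec_eq_iff forall_3)

theorem theorem3p7:
  fixes M :: "'w measure"
  assumes "prob_space M"
  shows
    "(\<forall>(D :: (real^'d) set) (g :: 'w \<Rightarrow> real^'d \<Rightarrow> real^'d).
        compact D \<and> C1_gaussian_process M D g \<and>
        divergence_free_on D (gp_mean M g) \<and>
        (\<forall>x'\<in>D. \<forall>j. divergence_free_on D (\<lambda>x. column j (gp_cov M g x x')))
        \<longrightarrow> divergence_free_process M D g)
   \<and> (\<forall>(D :: (real^2) set) (g :: 'w \<Rightarrow> real^2 \<Rightarrow> real^2).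
        compact D \<and> C1_gaussian_process M D g \<and>
        rotation_free2_on D (gp_mean M g) \<and>
        (\<forall>x'\<in>D. \<forall>j. rotation_free2_on D (\<lambda>x. column j (gp_cov M g x x')))
        \<longrightarrow> rotation_free2_process M D g)
   \<and> (\<forall>(D :: (real^3) set) (g :: 'w \<Rightarrow> real^3 \<Rightarrow> real^3).
        compact D \<and> C1_gaussian_process M D g \<and>
        rotation_free3_on D (gp_mean M g) \<and>
        (\<forall>x'\<in>D. \<forall>j. rotation_free3_on D (\<lambda>x. column j (gp_cov M g x x')))
        \<longrightarrow> rotation_free3_process M D g)"
proof (intro conjI allI impI)
  interpret prob_space M by (rule assms)
  {
    fix D :: "(real^'d) set" and g :: "'w \<Rightarrow> real^'d \<Rightarrow> real^'d"
    assume *: "compact D \<and> C1_gaussian_process M D g \<and> divergence_free_on D (gp_mean M g) \<and>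
        (\<forall>x'\<in>D. \<forall>j. divergence_free_on D (\<lambda>x. column j (gp_cov M g x x')))"
    have "AE \<omega> in M. \<forall>x. first_order_op (\<lambda>i k. if i = k then 1 else 0) D (g \<omega>) x = 0"
      by (rule first_order_op_gaussian_process_zero)
         (use * in \<open>auto simp: divergence_free_on_def div_on_first_order\<close>)
    then show "divergence_free_process M D g"
      using * by (auto simp: divergence_free_process_def div_on_first_order elim: eventually_mono)
  next
    fix D :: "(real^2) set" and g :: "'w \<Rightarrow> real^2 \<Rightarrow> real^2"
    assume *: "compact D \<and> C1_gaussian_process M D g \<and> rotation_free2_on D (gp_mean M g) \<and>
        (\<forall>x'\<in>D. \<forall>j. rotation_free2_on D (\<lambda>x. column j (gp_cov M g x x')))"
    have "AE \<omega> in M. \<forall>x. first_order_op (rot_coeff 1 2) D (g \<omega>) x = 0"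
      by (rule first_order_op_gaussian_process_zero)
         (use * in \<open>auto simp: rotation_free2_on_def curl2_on_first_order\<close>)
    then show "rotation_free2_process M D g"
      using * by (auto simp: rotation_free2_process_def curl2_on_first_order elim: eventually_mono)
  next
    fix D :: "(real^3) set" and g :: "'w \<Rightarrow> real^3 \<Rightarrow> real^3"
    assume *: "compact D \<and> C1_gaussian_process M D g \<and> rotation_free3_on D (gp_mean M g) \<and>
        (\<forall>x'\<in>D. \<forall>j. rotation_free3_on D (\<lambda>x. column j (gp_cov M g x x')))"
    have "AE \<omega> in M. \<forall>x. first_order_op A D (g \<omega>) x = 0"
      if "A \<in> {rot_coeff 2 3, rot_coeff 3 1, rot_coeff 1 2}" for A
      by (rule first_order_op_gaussian_process_zero)
         (use * that in \<open>auto simp: rotation_free3_on_def curl3_on_eq_0_iff\<close>)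
    \<comment> \<open>Three null sets are merged into one, so that all components of the curl vanish
      simultaneously.\<close>
    then have "AE \<omega> in M. \<forall>A\<in>{rot_coeff 2 3, rot_coeff 3 1, rot_coeff 1 2}.
        \<forall>x. first_order_op A D (g \<omega>) x = 0"
      by (intro AE_ball_countable') auto
    then have "AE \<omega> in M. \<forall>x\<in>D. curl3_on D (g \<omega>) x = 0"
      by eventually_elim (simp add: curl3_on_eq_0_iff)
    then show "rotation_free3_process M D g"
      using * by (simp add: rotation_free3_process_def)
  }
qed

end
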